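(* For every composition $\alpha$, the set $\mathbf{B}(\alpha)$ of quasi-ribbon tableaux of shape $\alpha$ with entries in $\mathcal{N}$ is a $\mathfrak{gl}_{\mathcal N}$-crystal, and $$\mathbf{B}(\alpha)=\{\,f_{i_1}\cdots f_{i_r}H_\alpha \mid r\ge 0,\ i_1,\dots,i_r\in I\,\}\setminus\{\mathbf 0\}.$$ In particular, $\mathbf{B}(\alpha)$ is connected with a unique highest weight element $H_\alpha$.
   Context: $\mathcal N=\frac12\mathbb Z_{>0}$ with its usual linear order; elements of $\mathbb Z_{>0}$ are even, elements of $\frac12+\mathbb Z_{\ge0}$ are odd. $I=\frac12\mathbb Z_{>0}$. $P=\bigoplus_{b\in\mathcal N}\mathbb Z\epsilon_b$ with symmetric bilinear form $(\epsilon_a,\epsilon_b)=(-1)^{|a|}\delta_{ab}$ ($|a|$ the parity). Simple roots: $\alpha_i=\epsilon_i-\epsilon_{i+\frac12}$, $i\in I$ (all isotropic). For $\lambda,\mu\in P$, $\lambda\ge\mu$ means $\lambda-\mu\in\sum_i\mathbb Z_{\ge0}\alpha_i$. A $\mathfrak{gl}_{\mathcal N}$-crystal is a set $B$ with maps $\mathrm{wt}:B\to P$, $\varepsilon_i,\varphi_i:B\to\mathbb Z_{\ge0}$, $e_i,f_i:B\to B\cup\{\mathbf 0\}$ ($i\in I$; $\mathbf 0$ a formal symbol not in $B$, with $e_i\mathbf 0=f_i\mathbf 0=\mathbf 0$) such that: (1) $\varphi_i(b)+\varepsilon_i(b)$ is $1$ if $(\mathrm{wt}(b),\alpha_i)\ne0$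 and $0$ otherwise; (2) if $e_ib\in B$ then $\varepsilon_i(e_ib)=\varepsilon_i(b)-1$, $\varphi_i(e_ib)=\varphi_i(b)+1$, $\mathrm{wt}(e_ib)=\mathrm{wt}(b)+\alpha_i$; (3) if $f_ib\in B$ then $\varepsilon_i(f_ib)=\varepsilon_i(b)+1$, $\varphi_i(f_ib)=\varphi_i(b)-1$, $\mathrm{wt}(f_ib)=\mathrm{wt}(b)-\alpha_i$; (4) $f_ib=b'$ iff $b=e_ib'$. It is viewed as an $I$-colored oriented graph ($b\xrightarrow{i}b'$ iff $b'=f_ib$); connectedness refers to this graph. Crystal of words: $\mathbf W$ is the set of finite words in $\mathcal N$ (including the empty word), $\mathrm{wt}(w_1\cdots w_r)=\sum_k\epsilon_{w_k}$. On letters, $f_i(i)=i+\frac12$, $e_i(i+\frac12)=i$, and all other $e_i,f_i$ on letters give $\mathbf 0$. On a word $w=w_1\cdots w_r$: for $i\in\mathbb Z_{>0}$ (resp. $i\in\frac12+\mathbb Z_{\ge0}$) let $k$ be the smallest (resp. largest) index with $w_k\in\{i,i+\frac12\}$; $e_iw$, $f_iw$ are obtained by applying $e_i$, $f_i$ to the letter $w_k$ ($\mathbf 0$ if the result on the letter is $\mathbf 0$); if no such $k$ exists, $e_iw=f_iw=\mathbf 0$. $\varepsilon_i(w)=1$ if $e_iw\neq\mathbf 0$ and $0$ otherwise; $\varphi_i(w)=1$ if $f_iw\ne\mathbf 0$ and $0$ otherwise. A composition $\alpha=(\alpha_1,\dots,\alpha_t)$ is a finite sequence of positive integers, identified with its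 ribbon diagram: rows from top to bottom have $\alpha_1,\dots,\alpha_t$ nodes, and the first (leftmost) node of row $i+1$ is directly below the last (rightmost) node of row $i$. A quasi-ribbon tableau of shape $\alpha$ is a filling of the ribbon diagram with entries in $\mathcal N$ such that entries weakly increase along rows (left to right) and columns (top to bottom), integer entries strictly increase in each column, and half-integer (odd) entries strictly increase in each row. For such $T$, $w(T)\in\mathbf W$ is obtained by reading rows from top to bottom, each row from right to left. The maps $\mathrm{wt},\varepsilon_i,\varphi_i$ on $\mathbf B(\alpha)$ are those of $w(T)$, and for $x=e,f$, $x_iT$ is the tableau of shape $\alpha$ with $w(x_iT)=x_iw(T)$ ($x_iT=\mathbf 0$ if $x_iw(T)=\mathbf 0$). $H_\alpha\in\mathbf B(\alpha)$: enumerate the nodes of $\alpha$ from northwest to southeast as $x_1,x_2,\dots$. Then $H_\alpha(x_1)=\frac12$; if $x_{k+1}$ is to the right of $x_k$, then $H_\alpha(x_{k+1})=H_\alpha(x_k)$ if $H_\alpha(x_k)$ is an integer and $H_\alpha(x_k)+\frac12$ otherwise; if $x_{k+1}$ is below $x_k$, then $H_\alpha(x_{k+1})=H_\alpha(x_k)$ if $H_\alpha(x_k)$ is a half-integer in $\frac12+\mathbb Z_{\ge0}$ and $H_\alpha(x_k)+\frac12$ otherwise. A highest weight element of a crystal $B$ is an element $H$ with $\mathrm{wt}(H)\ge\mathrm{wt}(T)$ for all $T\in B$. *)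

theory Defs
  imports Complex_Main "HOL-Library.Poly_Mapping" "HOL-Library.FuncSet"
begin

text \<open>The positive half-integers; the type serves both as the alphabet and as the index
  set of the simple roots and crystal operators.\<close>

typedef letter = "{x :: rat. 0 < x \<and> 2 * x \<in> \<int>}"
  morphisms val Letter
proof
  show "(1 / 2 :: rat) \<in> {x. 0 < x \<and> 2 * x \<in> \<int>}"
    by simp
qed

instantiation letter :: linorder
begin

definition "a \<le> b \<longleftrightarrow> val a \<le> val b"

definition "a < b \<longleftrightarrow> val a < val b" for a b :: letter

instance
  by standard (auto simp: less_eq_letter_def less_letter_def val_inject)

end

definition half :: letter
  where "half = Letter (1 / 2)"

definition up :: "letter \<Rightarrow> letter"
  where "up a = Letter (val a + 1 / 2)"

definition even_letter :: "letter \<Rightarrow> bool"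
  where "even_letter a \<longleftrightarrow> val a \<in> \<int>"

lemma val_half: "val half = 1 / 2"
  unfolding half_def by (rule Letter_inverse) simp

lemma val_up: "val (up a) = val a + 1 / 2"
  unfolding up_def by (rule Letter_inverse) (use val[of a] in \<open>auto simp: distrib_left\<close>)


subsection \<open>The weight lattice\<close>

type_synonym weight = "letter \<Rightarrow>\<^sub>0 int"

abbreviation \<epsilon> :: "letter \<Rightarrow> weight"
  where "\<epsilon> a \<equiv> frag_of a"

definition sgn_parity :: "letter \<Rightarrow> int"
  where "sgn_parity a = (if even_letter a then 1 else - 1)"

definition form :: "weight \<Rightarrow> weight \<Rightarrow> int"
  where "form \<mu> \<nu> = (\<Sum>a\<in>Poly_Mapping.keys \<mu>. sgn_parity a * Poly_Mapping.lookup \<mu> a * Poly_Mapping.lookup \<nu> a)"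

definition simple_root :: "letter \<Rightarrow> weight"
  where "simple_root i = \<epsilon> i - \<epsilon> (up i)"

definition weight_ge :: "weight \<Rightarrow> weight \<Rightarrow> bool"
  where "weight_ge \<mu> \<nu> \<longleftrightarrow>
    (\<exists>c :: letter \<Rightarrow>\<^sub>0 nat.
       \<mu> - \<nu> = (\<Sum>i\<in>Poly_Mapping.keys c. frag_cmul (int (Poly_Mapping.lookup c i)) (simple_root i)))"

lemma form_\<epsilon>: "form (\<epsilon> a) (\<epsilon> b) = (if a = b then sgn_parity a else 0)"
  by (simp add: form_def lookup_single when_def)

lemma form_superset:
  assumes "finite A" "Poly_Mapping.keys \<mu> \<subseteq> A"
  shows "form \<mu> \<nu> = (\<Sum>a\<in>A. sgn_parity a * Poly_Mapping.lookup \<mu> a * Poly_Mapping.lookup \<nu> a)"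
  unfolding form_def using assms
  by (intro sum.mono_neutral_left) (auto simp: in_keys_iff)

lemma form_commute: "form \<mu> \<nu> = form \<nu> \<mu>"
  using form_superset[of "Poly_Mapping.keys \<mu> \<union> Poly_Mapping.keys \<nu>" \<mu> \<nu>]
    form_superset[of "Poly_Mapping.keys \<mu> \<union> Poly_Mapping.keys \<nu>" \<nu> \<mu>]
  by (simp add: mult_ac)

lemma form_add_right: "form \<mu> (\<nu> + \<nu>') = form \<mu> \<nu> + form \<mu> \<nu>'"
  by (simp add: form_def lookup_add algebra_simps sum.distrib)


subsection \<open>Crystals\<close>

text \<open>The formal symbol \<open>\<zero>\<close> is \<^const>\<open>None\<close>.\<close>

record 'b crystal =
  elems :: "'b set"
  wt :: "'b \<Rightarrow> weight"
  eps :: "letter \<Rightarrow> 'b \<Rightarrow> nat"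
  phi :: "letter \<Rightarrow> 'b \<Rightarrow> nat"
  e_op :: "letter \<Rightarrow> 'b \<Rightarrow> 'b option"
  f_op :: "letter \<Rightarrow> 'b \<Rightarrow> 'b option"

definition gl_crystal :: "'b crystal \<Rightarrow> bool"
  where "gl_crystal C \<longleftrightarrow>
    (\<forall>i. \<forall>b\<in>elems C.
       e_op C i b \<in> insert None (Some ` elems C) \<and>
       f_op C i b \<in> insert None (Some ` elems C)) \<and>
    (\<forall>i. \<forall>b\<in>elems C.
       phi C i b + eps C i b = (if form (wt C b) (simple_root i) \<noteq> 0 then 1 else 0)) \<and>
    (\<forall>i. \<forall>b\<in>elems C. \<forall>b'\<in>elems C. e_op C i b = Some b' \<longrightarrow>
       int (eps C i b') = int (eps C i b) - 1 \<and>
       int (phi C i b') = int (phi C i b) + 1 \<and>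
       wt C b' = wt C b + simple_root i) \<and>
    (\<forall>i. \<forall>b\<in>elems C. \<forall>b'\<in>elems C. f_op C i b = Some b' \<longrightarrow>
       int (eps C i b') = int (eps C i b) + 1 \<and>
       int (phi C i b') = int (phi C i b) - 1 \<and>
       wt C b' = wt C b - simple_root i) \<and>
    (\<forall>i. \<forall>b\<in>elems C. \<forall>b'\<in>elems C. f_op C i b = Some b' \<longleftrightarrow> e_op C i b' = Some b)"

definition arrows :: "'b crystal \<Rightarrow> ('b \<times> 'b) set"
  where "arrows C = {(b, b'). b \<in> elems C \<and> b' \<in> elems C \<and> (\<exists>i. f_op C i b = Some b')}"

definition connected_crystal :: "'b crystal \<Rightarrow> bool"
  where "connected_crystal C \<longleftrightarrow>
    (\<forall>b\<in>elems C. \<forall>b'\<in>elems C. (b, b') \<in> (arrows C \<union> (arrows C)\<inverse>)\<^sup>*)"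

definition highest_weight_element :: "'b crystal \<Rightarrow> 'b \<Rightarrow> bool"
  where "highest_weight_element C H \<longleftrightarrow>
    H \<in> elems C \<and> (\<forall>b\<in>elems C. weight_ge (wt C H) (wt C b))"

text \<open>\<open>f_seq C [i\<^sub>1, \<dots>, i\<^sub>r] x\<close> is \<open>f\<^bsub>i\<^sub>1\<^esub> \<cdots> f\<^bsub>i\<^sub>r\<^esub> x\<close>, where \<open>f\<^sub>i \<zero> = \<zero>\<close>.\<close>

definition f_seq :: "'b crystal \<Rightarrow> letter list \<Rightarrow> 'b option \<Rightarrow> 'b option"
  where "f_seq C js x = foldr (\<lambda>i y. Option.bind y (f_op C i)) js x"


subsection \<open>The crystal of words\<close>

definition e_letter :: "letter \<Rightarrow> letter \<Rightarrow> letter option"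
  where "e_letter i a = (if a = up i then Some i else None)"

definition f_letter :: "letter \<Rightarrow> letter \<Rightarrow> letter option"
  where "f_letter i a = (if a = i then Some (up i) else None)"

definition positions :: "letter \<Rightarrow> letter list \<Rightarrow> nat set"
  where "positions i w = {k. k < length w \<and> w ! k \<in> {i, up i}}"

definition active_position :: "letter \<Rightarrow> letter list \<Rightarrow> nat"
  where "active_position i w =
    (if even_letter i then Min (positions i w) else Max (positions i w))"

definition act_word ::
    "(letter \<Rightarrow> letter \<Rightarrow> letter option) \<Rightarrow> letter \<Rightarrow> letter list \<Rightarrow> letter list option"
  where "act_word x i w =
    (if positions i w = {} then None
     else map_option (\<lambda>a. w[active_position i w := a]) (x i (w ! active_position i w)))"

definition word_crystal :: "letter list crystal"
  where "word_crystal =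
    \<lparr>elems = UNIV,
     wt = (\<lambda>w. \<Sum>a\<leftarrow>w. \<epsilon> a),
     eps = (\<lambda>i w. if act_word e_letter i w \<noteq> None then 1 else 0),
     phi = (\<lambda>i w. if act_word f_letter i w \<noteq> None then 1 else 0),
     e_op = act_word e_letter,
     f_op = act_word f_letter\<rparr>"


subsection \<open>Ribbon diagrams and quasi-ribbon tableaux\<close>

definition composition :: "nat list \<Rightarrow> bool"
  where "composition \<alpha> \<longleftrightarrow> (\<forall>a\<in>set \<alpha>. 0 < a)"

text \<open>Nodes are pairs (row, column), both numbered from 0, rows from top to bottom and columns
  from left to right. Each row starts in the column in which the preceding one ends.\<close>

definition row_start :: "nat list \<Rightarrow> nat \<Rightarrow> nat"
  where "row_start \<alpha> r = (\<Sum>q<r. \<alpha> ! q - 1)"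

definition row_nodes :: "nat list \<Rightarrow> nat \<Rightarrow> (nat \<times> nat) list"
  where "row_nodes \<alpha> r = map (Pair r) [row_start \<alpha> r ..< row_start \<alpha> r + \<alpha> ! r]"

definition ribbon :: "nat list \<Rightarrow> (nat \<times> nat) set"
  where "ribbon \<alpha> = (\<Union>r<length \<alpha>. set (row_nodes \<alpha> r))"

type_synonym filling = "nat \<times> nat \<Rightarrow> letter"

definition fillings :: "nat list \<Rightarrow> filling set"
  where "fillings \<alpha> = ribbon \<alpha> \<rightarrow>\<^sub>E UNIV"

definition quasi_ribbon_tableaux :: "nat list \<Rightarrow> filling set"
  where "quasi_ribbon_tableaux \<alpha> = {T \<in> fillings \<alpha>.
    (\<forall>r c c'. (r, c) \<in> ribbon \<alpha> \<and> (r, c') \<in> ribbon \<alpha> \<and> c < c' \<longrightarrow>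
       T (r, c) \<le> T (r, c') \<and>
       (\<not> even_letter (T (r, c)) \<and> \<not> even_letter (T (r, c')) \<longrightarrow> T (r, c) < T (r, c'))) \<and>
    (\<forall>r r' c. (r, c) \<in> ribbon \<alpha> \<and> (r', c) \<in> ribbon \<alpha> \<and> r < r' \<longrightarrow>
       T (r, c) \<le> T (r', c) \<and>
       (even_letter (T (r, c)) \<and> even_letter (T (r', c)) \<longrightarrow> T (r, c) < T (r', c)))}"

definition reading_nodes :: "nat list \<Rightarrow> (nat \<times> nat) list"
  where "reading_nodes \<alpha> = concat (map (\<lambda>r. rev (row_nodes \<alpha> r)) [0..<length \<alpha>])"

definition reading_word :: "nat list \<Rightarrow> filling \<Rightarrow> letter list"
  where "reading_word \<alpha> T = map T (reading_nodes \<alpha>)"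

text \<open>The filling of shape \<open>\<alpha>\<close> with a given reading word. That it is again a quasi-ribbon
  tableau, when the word arises from one by a crystal operator, is not built in here: it is part
  of the crystal property of \<open>ribbon_crystal \<alpha>\<close>.\<close>

definition filling_of_word :: "nat list \<Rightarrow> letter list \<Rightarrow> filling"
  where "filling_of_word \<alpha> v = (THE T. T \<in> fillings \<alpha> \<and> reading_word \<alpha> T = v)"

definition ribbon_crystal :: "nat list \<Rightarrow> filling crystal"
  where "ribbon_crystal \<alpha> =
    \<lparr>elems = quasi_ribbon_tableaux \<alpha>,
     wt = (\<lambda>T. wt word_crystal (reading_word \<alpha> T)),
     eps = (\<lambda>i T. eps word_crystal i (reading_word \<alpha> T)),
     phi = (\<lambda>i T. phi word_crystal i (reading_word \<alpha> T)),
     e_op = (\<lambda>i T. map_option (filling_of_word \<alpha>) (e_op word_crystal i (reading_word \<alpha> T))),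
     f_op = (\<lambda>i T. map_option (filling_of_word \<alpha>) (f_op word_crystal i (reading_word \<alpha> T)))\<rparr>"

lemma set_reading_nodes: "set (reading_nodes \<alpha>) = ribbon \<alpha>"
  by (auto simp: reading_nodes_def ribbon_def)

lemma distinct_reading_nodes: "distinct (reading_nodes \<alpha>)"
proof -
  have "distinct (concat (map (\<lambda>r. rev (row_nodes \<alpha> r)) [0..<n]))" for n
    by (induction n) (auto simp: row_nodes_def distinct_map inj_on_def)
  then show ?thesis
    by (simp add: reading_nodes_def)
qed

lemma ex1_filling_of_word:
  assumes "length v = length (reading_nodes \<alpha>)"
  shows "\<exists>!T. T \<in> fillings \<alpha> \<and> reading_word \<alpha> T = v"
proof (rule ex_ex1I)
  define T where "T = restrict (\<lambda>x. the (map_of (zip (reading_nodes \<alpha>) v) x)) (ribbon \<alpha>)"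
  have "T (reading_nodes \<alpha> ! k) = v ! k" if "k < length v" for k
  proof -
    have "reading_nodes \<alpha> ! k \<in> ribbon \<alpha>"
      using that assms nth_mem[of k "reading_nodes \<alpha>"] by (simp add: set_reading_nodes)
    moreover have "map_of (zip (reading_nodes \<alpha>) v) (reading_nodes \<alpha> ! k) = Some (v ! k)"
      using that assms by (intro map_of_zip_nth) (auto simp: distinct_reading_nodes)
    ultimately show ?thesis
      by (simp add: T_def)
  qed
  then have "reading_word \<alpha> T = v"
    using assms by (intro nth_equalityI) (auto simp: reading_word_def)
  moreover have "T \<in> fillings \<alpha>"
    by (simp add: T_def fillings_def)
  ultimately show "\<exists>T. T \<in> fillings \<alpha> \<and> reading_word \<alpha> T = v"
    by blast
next
  fix T T'
  assume T: "T \<in> fillings \<alpha> \<and> reading_word \<alpha> T = v" "T' \<in> fillings \<alpha> \<and> reading_word \<alpha> T' = v"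
  then have "\<forall>x\<in>ribbon \<alpha>. T x = T' x"
    by (auto simp: reading_word_def simp flip: set_reading_nodes)
  with T show "T = T'"
    by (auto simp: fillings_def intro: PiE_ext)
qed


subsection \<open>The tableau \<open>H\<^sub>\<alpha>\<close>\<close>

text \<open>The nodes from northwest to southeast; consecutive nodes lie in the same row precisely
  when the second is to the right of the first.\<close>

definition ribbon_nodes :: "nat list \<Rightarrow> (nat \<times> nat) list"
  where "ribbon_nodes \<alpha> = concat (map (row_nodes \<alpha>) [0..<length \<alpha>])"

primrec H_entry :: "nat list \<Rightarrow> nat \<Rightarrow> letter"
  where
    "H_entry \<alpha> 0 = half"
  | "H_entry \<alpha> (Suc k) =
      (if fst (ribbon_nodes \<alpha> ! Suc k) = fst (ribbon_nodes \<alpha> ! k)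
       then if even_letter (H_entry \<alpha> k) then H_entry \<alpha> k else up (H_entry \<alpha> k)
       else if even_letter (H_entry \<alpha> k) then up (H_entry \<alpha> k) else H_entry \<alpha> k)"

definition H_tab :: "nat list \<Rightarrow> filling"
  where "H_tab \<alpha> =
    (\<lambda>x\<in>ribbon \<alpha>. H_entry \<alpha> (THE k. k < length (ribbon_nodes \<alpha>) \<and> ribbon_nodes \<alpha> ! k = x))"

end

theory Submission
  imports Defs
begin

text \<open>The crystal axioms already hold for words, so for tableaux only closedness under the operators
  is at stake. It holds because the node on which \<open>e\<^sub>i\<close> or \<open>f\<^sub>i\<close> acts comes first (\<open>i\<close> even) or last
  (\<open>i\<close> odd) in the reading order among all nodes with entry \<open>i\<close> or \<open>i + 1/2\<close>, which keeps those
  entries off the neighbours that could violate the tableau conditions. Along the path from northwest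
  to southeast the entries increase weakly; if no \<open>e\<^sub>i\<close> applies, each entry must be the least one
  allowed by its predecessor, so the tableau is \<open>H\<^sub>\<alpha>\<close>. As \<open>e\<^sub>i\<close> lowers the sum of the entries, every
  tableau can be raised to \<open>H\<^sub>\<alpha>\<close>. A highest weight element admits no \<open>e\<^sub>i\<close> and is therefore \<open>H\<^sub>\<alpha>\<close>.\<close>

subsection \<open>Letters\<close>

text \<open>Identifies the alphabet with the positive integers, so that goals on order, parity and
  \<open>up\<close> become arithmetic of natural numbers.\<close>

definition rank :: "letter \<Rightarrow> nat"
  where "rank a = nat \<lfloor>2 * val a\<rfloor>"

lemma of_nat_rank: "of_nat (rank a) = 2 * val a"
proof -
  have "0 < val a" "2 * val a \<in> \<int>"
    using val[of a] by auto
  then show ?thesis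
    by (auto simp: rank_def elim!: Ints_cases)
qed

lemma letter_less_iff_rank: "a < b \<longleftrightarrow> rank a < rank b"
proof -
  have "a < b \<longleftrightarrow> (of_nat (rank a) :: rat) < of_nat (rank b)"
    by (simp only: of_nat_rank) (simp add: less_letter_def)
  then show ?thesis
    by simp
qed

lemma letter_le_iff_rank: "a \<le> b \<longleftrightarrow> rank a \<le> rank b"
  using letter_less_iff_rank[of b a] by auto

lemma letter_eq_iff_rank: "a = b \<longleftrightarrow> rank a = rank b"
  using letter_le_iff_rank[of a b] letter_le_iff_rank[of b a] by auto

lemma rank_up [simp]: "rank (up a) = Suc (rank a)"
proof -
  have "(of_nat (rank (up a)) :: rat) = of_nat (Suc (rank a))"
    by (simp only: of_nat_rank of_nat_Suc val_up) simp
  then show ?thesis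
    by (simp only: of_nat_eq_iff)
qed

lemma rank_half [simp]: "rank half = 1"
proof -
  have "(of_nat (rank half) :: rat) = of_nat 1"
    by (simp only: of_nat_rank val_half)
  then show ?thesis
    by (simp only: of_nat_eq_iff)
qed

lemma even_letter_iff_rank: "even_letter a \<longleftrightarrow> even (rank a)"
proof
  assume "even_letter a"
  then obtain z where z: "val a = of_int z"
    by (auto simp: even_letter_def elim: Ints_cases)
  have "(of_int (int (rank a)) :: rat) = of_int (2 * z)"
    using of_nat_rank[of a] z by simp
  then have "int (rank a) = 2 * z"
    by (simp only: of_int_eq_iff)
  then show "even (rank a)"
    by presburger
next
  assume "even (rank a)"
  then obtain m where "rank a = 2 * m" ..
  then have "val a = of_nat m"
    using of_nat_rank[of a] by simp
  then show "even_letter a"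
    by (simp add: even_letter_def)
qed

lemma even_letter_up [simp]: "even_letter (up a) \<longleftrightarrow> \<not> even_letter a"
  by (simp add: even_letter_iff_rank)

lemma up_neq [simp]: "up a \<noteq> a" "a \<noteq> up a"
  by (auto simp: letter_eq_iff_rank)

lemma rank_pos [simp]: "0 < rank a"
  using of_nat_rank[of a] val[of a]
  by (metis mem_Collect_eq mult_pos_pos of_nat_0_less_iff zero_less_numeral)

text \<open>Supplies, for every entry other than \<open>half\<close>, the index i whose e_i could
  lower it.\<close>

lemma letter_cases: "a = half \<or> (\<exists>i. a = up i)"
proof (cases "val a = 1 / 2")
  case True
  then show ?thesis
    by (metis val_half val_inject)
next
  case False
  have "rank a \<noteq> 1"
    using of_nat_rank[of a] False by auto
  then have "2 \<le> rank a"
    using rank_pos[of a] by linarith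
  then have "(2 :: rat) \<le> of_nat (rank a)"
    by (metis of_nat_le_iff of_nat_numeral)
  then have "0 < val a - 1 / 2"
    by (simp add: of_nat_rank)
  moreover have "2 * (val a - 1 / 2) \<in> \<int>"
    using val[of a] by (simp add: right_diff_distrib)
  ultimately have "val (Letter (val a - 1 / 2)) = val a - 1 / 2"
    by (intro Letter_inverse) simp
  then have "val (up (Letter (val a - 1 / 2))) = val a"
    by (simp add: val_up)
  then show ?thesis
    by (metis val_inject)
qed


subsection \<open>The crystal of words\<close>

lemma finite_positions: "finite (positions i w)"
  by (simp add: positions_def)

lemma active_position_mem: "positions i w \<noteq> {} \<Longrightarrow> active_position i w \<in> positions i w"
  by (simp add: active_position_def finite_positions)

lemma active_position_le: "k \<in> positions i w \<Longrightarrow> even_letter i \<Longrightarrow> active_position i w \<le> k"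
  by (simp add: active_position_def finite_positions)

lemma active_position_ge: "k \<in> positions i w \<Longrightarrow> \<not> even_letter i \<Longrightarrow> k \<le> active_position i w"
  by (simp add: active_position_def finite_positions)

lemma positions_update:
  "k \<in> positions i w \<Longrightarrow> b \<in> {i, up i} \<Longrightarrow> positions i (w[k := b]) = positions i w"
  by (auto simp: positions_def nth_list_update split: if_splits)

lemma act_word_e_eq_Some_iff:
  "act_word e_letter i w = Some v \<longleftrightarrow>
    positions i w \<noteq> {} \<and> w ! active_position i w = up i \<and> v = w[active_position i w := i]"
  by (auto simp: act_word_def e_letter_def)

lemma act_word_f_eq_Some_iff:
  "act_word f_letter i w = Some v \<longleftrightarrow>
    positions i w \<noteq> {} \<and> w ! active_position i w = i \<and> v = w[active_position i w := up i]"
  by (auto simp: act_word_def f_letter_def)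

text \<open>Replacing i by \<open>up i\<close>, or back, does not change the set of positions held
  by these two letters. The active position therefore stays put, and the opposite operator undoes
  the change.\<close>

lemma act_word_f_e_inverse:
  "act_word f_letter i w = Some v \<longleftrightarrow> act_word e_letter i v = Some w"
proof -
  have *: "positions i (w[active_position i w := b]) = positions i w"
    "active_position i (w[active_position i w := b]) = active_position i w"
    "w[active_position i w := b] ! active_position i w = b"
    if "positions i w \<noteq> {}" "b \<in> {i, up i}" for w b
  proof -
    show **: "positions i (w[active_position i w := b]) = positions i w"
      using positions_update[OF active_position_mem] that by blast
    show "active_position i (w[active_position i w := b]) = active_position i w"
      unfolding active_position_def[of i "w[_ := _]"] ** by (simp add: active_position_def)
    show "w[active_position i w := b] ! active_position i w = b"
      using active_position_mem[OF that(1)] by (simp add: positions_def)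
  qed
  show ?thesis
  proof
    assume "act_word f_letter i w = Some v"
    then have "positions i w \<noteq> {}" "w ! active_position i w = i" "v = w[active_position i w := up i]"
      by (simp_all add: act_word_f_eq_Some_iff)
    then show "act_word e_letter i v = Some w"
      using *[of w "up i"] list_update_id[of w "active_position i w"]
      by (simp add: act_word_e_eq_Some_iff)
  next
    assume "act_word e_letter i v = Some w"
    then have "positions i v \<noteq> {}" "v ! active_position i v = up i" "w = v[active_position i v := i]"
      by (simp_all add: act_word_e_eq_Some_iff)
    then show "act_word f_letter i w = Some v"
      using *[of v i] list_update_id[of v "active_position i v"]
      by (simp add: act_word_f_eq_Some_iff)
  qed
qed

lemma eps_phi_word:
  "phi word_crystal i w = (if positions i w \<noteq> {} \<and> w ! active_position i w = i then 1 else 0)"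
  "eps word_crystal i w = (if positions i w \<noteq> {} \<and> w ! active_position i w = up i then 1 else 0)"
  by (auto simp: word_crystal_def act_word_def f_letter_def e_letter_def)

lemma wt_word_update:
  "k < length w \<Longrightarrow> wt word_crystal (w[k := b]) = wt word_crystal w - \<epsilon> (w ! k) + \<epsilon> b"
  by (induction w arbitrary: k) (auto simp: word_crystal_def algebra_simps split: nat.split)

lemma form_diff_right: "form \<mu> (\<nu> - \<nu>') = form \<mu> \<nu> - form \<mu> \<nu>'"
  using form_add_right[of \<mu> "\<nu> - \<nu>'" \<nu>'] by simp

text \<open>The letters i and \<open>up i\<close> have opposite parity and enter the simple root
  with opposite signs, so each occurrence of either contributes the same sign and nothing
  cancels.\<close>

lemma form_wt_word_simple_root:
  "form (wt word_crystal w) (simple_root i) =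
    sgn_parity i * int (length (filter (\<lambda>a. a \<in> {i, up i}) w))"
proof (induction w)
  case Nil
  then show ?case
    by (simp add: word_crystal_def form_def)
next
  case (Cons a w)
  have "form (wt word_crystal (a # w)) (simple_root i) =
      form (\<epsilon> a) (simple_root i) + form (wt word_crystal w) (simple_root i)"
    by (simp add: word_crystal_def form_commute[of _ "simple_root i"] form_add_right)
  moreover have "form (\<epsilon> a) (simple_root i) = (if a \<in> {i, up i} then sgn_parity i else 0)"
    by (auto simp: simple_root_def form_diff_right form_\<epsilon> sgn_parity_def)
  ultimately show ?case
    using Cons by (simp add: algebra_simps)
qed

lemma form_wt_word_neq_0_iff:
  "form (wt word_crystal w) (simple_root i) \<noteq> 0 \<longleftrightarrow> positions i w \<noteq> {}"
proof -
  have "length (filter (\<lambda>a. a \<in> {i, up i}) w) = card (positions i w)"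
    unfolding positions_def by (rule length_filter_conv_card)
  then show ?thesis
    unfolding form_wt_word_simple_root by (simp add: sgn_parity_def finite_positions)
qed

text \<open>The active letter is either i or \<open>up i\<close>, so exactly one of the two
  operators applies as soon as there is a position at all.\<close>

lemma phi_eps_word:
  "phi word_crystal i w + eps word_crystal i w =
    (if form (wt word_crystal w) (simple_root i) \<noteq> 0 then 1 else 0)"
  unfolding form_wt_word_neq_0_iff eps_phi_word
  using active_position_mem[of i w] by (auto simp: positions_def)

lemma f_word_SomeD:
  assumes "act_word f_letter i w = Some v"
  shows "eps word_crystal i w = 0" "phi word_crystal i w = 1"
    "eps word_crystal i v = 1" "phi word_crystal i v = 0"
    "wt word_crystal v = wt word_crystal w - simple_root i"
proof -
  note f = assms[unfolded act_word_f_eq_Some_iff]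
  \<comment> \<open>The values at v are read off from the inverse move from v to w.\<close>
  note e = assms[unfolded act_word_f_e_inverse act_word_e_eq_Some_iff]
  show "eps word_crystal i w = 0" "phi word_crystal i w = 1"
    using f by (auto simp: eps_phi_word)
  show "eps word_crystal i v = 1" "phi word_crystal i v = 0"
    using e by (auto simp: eps_phi_word)
  have "active_position i w < length w"
    using f active_position_mem[of i w] by (auto simp: positions_def)
  then show "wt word_crystal v = wt word_crystal w - simple_root i"
    using f by (simp add: wt_word_update simple_root_def)
qed


subsection \<open>The reading order\<close>

definition reads_before :: "nat \<times> nat \<Rightarrow> nat \<times> nat \<Rightarrow> bool"
  where "reads_before x y \<longleftrightarrow> fst x < fst y \<or> fst x = fst y \<and> snd y < snd x"

text \<open>The active letter is chosen by its index in the word; this turns comparisons of indices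
  into comparisons of rows and columns.\<close>

lemma sorted_wrt_reading_nodes: "sorted_wrt reads_before (reading_nodes \<alpha>)"
proof -
  have "sorted_wrt (\<lambda>x y. reads_before y x) (row_nodes \<alpha> r)" for r
    unfolding row_nodes_def sorted_wrt_map
    by (rule sorted_wrt_mono_rel[OF _ sorted_wrt_upt]) (auto simp: reads_before_def)
  then have "sorted_wrt reads_before (concat (map (\<lambda>r. rev (row_nodes \<alpha> r)) [0..<n]))" for n
    by (induction n) (auto simp: sorted_wrt_append sorted_wrt_rev, auto simp: reads_before_def row_nodes_def)
  then show ?thesis
    by (simp add: reading_nodes_def)
qed

text \<open>Translates the rule on words into a rule on nodes: the operators change a single entry,
  at the extremal node in reading order. The letter map g is arbitrary, so one node x serves e_i and
  f_i alike.\<close>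

lemma active_node:
  assumes "y \<in> ribbon \<alpha>" "T y \<in> {i, up i}"
  obtains x where "x \<in> ribbon \<alpha>" "T x \<in> {i, up i}"
    "\<And>z. z \<in> ribbon \<alpha> \<Longrightarrow> T z \<in> {i, up i} \<Longrightarrow> z \<noteq> x \<Longrightarrow>
      if even_letter i then reads_before x z else reads_before z x"
    "\<And>g. act_word g i (reading_word \<alpha> T) =
      map_option (\<lambda>b. reading_word \<alpha> (T(x := b))) (g i (T x))"
proof
  let ?w = "reading_word \<alpha> T" and ?N = "reading_nodes \<alpha>"
  let ?k = "active_position i ?w"
  let ?x = "?N ! ?k"
  have pos: "positions i ?w = {k. k < length ?N \<and> T (?N ! k) \<in> {i, up i}}"
    by (auto simp: positions_def reading_word_def)
  obtain l where "l < length ?N" "?N ! l = y"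
    using assms(1) by (metis in_set_conv_nth set_reading_nodes)
  then have ne: "positions i ?w \<noteq> {}"
    using assms(2) pos by auto
  have k: "?k < length ?N" "T ?x \<in> {i, up i}"
    using active_position_mem[OF ne] by (auto simp: pos)
  show "?x \<in> ribbon \<alpha>"
    using k by (metis nth_mem set_reading_nodes)
  show "T ?x \<in> {i, up i}"
    by (fact k)
  show "if even_letter i then reads_before ?x z else reads_before z ?x"
    if z: "z \<in> ribbon \<alpha>" "T z \<in> {i, up i}" "z \<noteq> ?x" for z
  proof -
    obtain m where m: "m < length ?N" "?N ! m = z"
      using z(1) by (metis in_set_conv_nth set_reading_nodes)
    then have "m \<in> positions i ?w"
      using z(2) pos by auto
    moreover have "m \<noteq> ?k"
      using m z(3) by auto
    ultimately have "if even_letter i then ?k < m else m < ?k"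
      using active_position_le[of m i ?w] active_position_ge[of m i ?w] by auto
    then show ?thesis
      using sorted_wrt_nth_less[OF sorted_wrt_reading_nodes] m k by auto
  qed
  \<comment> \<open>The nodes are distinct, so changing the filling at one node changes exactly one
    letter.\<close>
  have "list_update ?w ?k = (\<lambda>b. reading_word \<alpha> (T(?x := b)))"
    using k(1) distinct_reading_nodes[of \<alpha>]
    by (intro ext nth_equalityI) (auto simp: reading_word_def nth_list_update nth_eq_iff_index_eq)
  moreover have "?w ! ?k = T ?x"
    using k(1) by (simp add: reading_word_def)
  ultimately show "act_word g i ?w =
      map_option (\<lambda>b. reading_word \<alpha> (T(?x := b))) (g i (T ?x))" for g
    using ne by (simp add: act_word_def)
qed

lemma act_word_reading_word_None:
  assumes "\<forall>y\<in>ribbon \<alpha>. T y \<notin> {i, up i}"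
  shows "act_word g i (reading_word \<alpha> T) = None"
proof -
  have "reading_nodes \<alpha> ! k \<in> ribbon \<alpha>" if "k < length (reading_nodes \<alpha>)" for k
    using that by (metis nth_mem set_reading_nodes)
  then have "positions i (reading_word \<alpha> T) = {}"
    using assms by (auto simp: positions_def reading_word_def)
  then show ?thesis
    by (simp add: act_word_def)
qed

section \<open>Fillings recovered from words, and the tableau conditions\<close>

lemma filling_of_reading_word:
  "T \<in> fillings \<alpha> \<Longrightarrow> filling_of_word \<alpha> (reading_word \<alpha> T) = T"
  unfolding filling_of_word_def
  by (rule the1_equality[OF ex1_filling_of_word]) (auto simp: reading_word_def)

lemma fillings_fun_upd: "T \<in> fillings \<alpha> \<Longrightarrow> x \<in> ribbon \<alpha> \<Longrightarrow> T(x := b) \<in> fillings \<alpha>"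
  by (auto simp: fillings_def PiE_def extensional_def)

text \<open>Strictness is traded for a condition on equal entries, which passes directly to ranks;
  for weakly ordered entries the two forms agree.\<close>

lemma quasi_ribbon_tableauI:
  assumes "T \<in> fillings \<alpha>"
    and "\<And>r c c'. (r, c) \<in> ribbon \<alpha> \<Longrightarrow> (r, c') \<in> ribbon \<alpha> \<Longrightarrow> c < c' \<Longrightarrow>
      T (r, c) \<le> T (r, c') \<and> (T (r, c) = T (r, c') \<longrightarrow> even_letter (T (r, c)))"
    and "\<And>r r' c. (r, c) \<in> ribbon \<alpha> \<Longrightarrow> (r', c) \<in> ribbon \<alpha> \<Longrightarrow> r < r' \<Longrightarrow>
      T (r, c) \<le> T (r', c) \<and> (T (r, c) = T (r', c) \<longrightarrow> \<not> even_letter (T (r, c)))"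
  shows "T \<in> quasi_ribbon_tableaux \<alpha>"
  using assms unfolding quasi_ribbon_tableaux_def
  by (auto simp: order.strict_iff_order)

lemma
  assumes "T \<in> quasi_ribbon_tableaux \<alpha>"
  shows quasi_ribbon_filling: "T \<in> fillings \<alpha>"
    and quasi_ribbon_row: "(r, c) \<in> ribbon \<alpha> \<Longrightarrow> (r, c') \<in> ribbon \<alpha> \<Longrightarrow> c < c' \<Longrightarrow>
      T (r, c) \<le> T (r, c') \<and> (T (r, c) = T (r, c') \<longrightarrow> even_letter (T (r, c)))"
    and quasi_ribbon_column: "(r, c) \<in> ribbon \<alpha> \<Longrightarrow> (r', c) \<in> ribbon \<alpha> \<Longrightarrow> r < r' \<Longrightarrow>
      T (r, c) \<le> T (r', c) \<and> (T (r, c) = T (r', c) \<longrightarrow> \<not> even_letter (T (r, c)))"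
  using assms unfolding quasi_ribbon_tableaux_def
  by (blast, fastforce+)


subsection \<open>The crystal operators on tableaux\<close>

text \<open>Raising the entry at x can only spoil comparisons with nodes to the right or below. For
  even i in rows and odd i in columns, extremality keeps i and \<open>up i\<close> off those nodes.
  In the other two cases strictness excludes i, and \<open>up i\<close> is allowed there because it
  has the other parity.\<close>

lemma quasi_ribbon_act_f:
  assumes T: "T \<in> quasi_ribbon_tableaux \<alpha>" and x: "x \<in> ribbon \<alpha>" "T x = i"
    and extremal: "\<And>z. z \<in> ribbon \<alpha> \<Longrightarrow> T z \<in> {i, up i} \<Longrightarrow> z \<noteq> x \<Longrightarrow>
      if even_letter i then reads_before x z else reads_before z x"
  shows "T(x := up i) \<in> quasi_ribbon_tableaux \<alpha>"
proof (rule quasi_ribbon_tableauI)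
  show "T(x := up i) \<in> fillings \<alpha>"
    using quasi_ribbon_filling[OF T] x(1) by (rule fillings_fun_upd)
next
  fix r c c'
  assume *: "(r, c) \<in> ribbon \<alpha>" "(r, c') \<in> ribbon \<alpha>" "c < c'"
  note row = quasi_ribbon_row[OF T *]
  \<comment> \<open>For even i the node x is read first, but rows are read from right to
    left.\<close>
  have "T (r, c') \<noteq> i \<and> T (r, c') \<noteq> up i" if "x = (r, c)" "even_letter i"
    using extremal[of "(r, c')"] that * by (auto simp: reads_before_def)
  then show "(T(x := up i)) (r, c) \<le> (T(x := up i)) (r, c') \<and>
      ((T(x := up i)) (r, c) = (T(x := up i)) (r, c') \<longrightarrow> even_letter ((T(x := up i)) (r, c)))"
    using row * x(2) by (auto simp: letter_le_iff_rank letter_eq_iff_rank even_letter_iff_rank) presburger+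
next
  fix r r' c
  assume *: "(r, c) \<in> ribbon \<alpha>" "(r', c) \<in> ribbon \<alpha>" "r < r'"
  note col = quasi_ribbon_column[OF T *]
  \<comment> \<open>For odd i the node x is read last, but lower rows are read later.\<close>
  have "T (r', c) \<noteq> i \<and> T (r', c) \<noteq> up i" if "x = (r, c)" "\<not> even_letter i"
    using extremal[of "(r', c)"] that * by (auto simp: reads_before_def)
  then show "(T(x := up i)) (r, c) \<le> (T(x := up i)) (r', c) \<and>
      ((T(x := up i)) (r, c) = (T(x := up i)) (r', c) \<longrightarrow> \<not> even_letter ((T(x := up i)) (r, c)))"
    using col * x(2) by (auto simp: letter_le_iff_rank letter_eq_iff_rank even_letter_iff_rank) presburger+
qed

text \<open>Mirror image of the case of f_i: now the nodes to the left and above are at stake, and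
  extremality is used for odd i in rows and even i in columns.\<close>

lemma quasi_ribbon_act_e:
  assumes T: "T \<in> quasi_ribbon_tableaux \<alpha>" and x: "x \<in> ribbon \<alpha>" "T x = up i"
    and extremal: "\<And>z. z \<in> ribbon \<alpha> \<Longrightarrow> T z \<in> {i, up i} \<Longrightarrow> z \<noteq> x \<Longrightarrow>
      if even_letter i then reads_before x z else reads_before z x"
  shows "T(x := i) \<in> quasi_ribbon_tableaux \<alpha>"
proof (rule quasi_ribbon_tableauI)
  show "T(x := i) \<in> fillings \<alpha>"
    using quasi_ribbon_filling[OF T] x(1) by (rule fillings_fun_upd)
next
  fix r c c'
  assume *: "(r, c) \<in> ribbon \<alpha>" "(r, c') \<in> ribbon \<alpha>" "c < c'"
  note row = quasi_ribbon_row[OF T *]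
  have "T (r, c) \<noteq> i \<and> T (r, c) \<noteq> up i" if "x = (r, c')" "\<not> even_letter i"
    using extremal[of "(r, c)"] that * by (auto simp: reads_before_def)
  then show "(T(x := i)) (r, c) \<le> (T(x := i)) (r, c') \<and>
      ((T(x := i)) (r, c) = (T(x := i)) (r, c') \<longrightarrow> even_letter ((T(x := i)) (r, c)))"
    using row * x(2) by (auto simp: letter_le_iff_rank letter_eq_iff_rank even_letter_iff_rank)
next
  fix r r' c
  assume *: "(r, c) \<in> ribbon \<alpha>" "(r', c) \<in> ribbon \<alpha>" "r < r'"
  note col = quasi_ribbon_column[OF T *]
  have "T (r, c) \<noteq> i \<and> T (r, c) \<noteq> up i" if "x = (r', c)" "even_letter i"
    using extremal[of "(r, c)"] that * by (auto simp: reads_before_def)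
  then show "(T(x := i)) (r, c) \<le> (T(x := i)) (r', c) \<and>
      ((T(x := i)) (r, c) = (T(x := i)) (r', c) \<longrightarrow> \<not> even_letter ((T(x := i)) (r, c)))"
    using col * x(2) by (auto simp: letter_le_iff_rank letter_eq_iff_rank even_letter_iff_rank)
qed

section \<open>The crystal axioms for tableaux\<close>

lemma ribbon_crystal_simps [simp]:
  "elems (ribbon_crystal \<alpha>) = quasi_ribbon_tableaux \<alpha>"
  "wt (ribbon_crystal \<alpha>) T = wt word_crystal (reading_word \<alpha> T)"
  "eps (ribbon_crystal \<alpha>) i T = eps word_crystal i (reading_word \<alpha> T)"
  "phi (ribbon_crystal \<alpha>) i T = phi word_crystal i (reading_word \<alpha> T)"
  by (simp_all add: ribbon_crystal_def)

lemma ribbon_crystal_ops: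
  "e_op (ribbon_crystal \<alpha>) i T =
    map_option (filling_of_word \<alpha>) (act_word e_letter i (reading_word \<alpha> T))"
  "f_op (ribbon_crystal \<alpha>) i T =
    map_option (filling_of_word \<alpha>) (act_word f_letter i (reading_word \<alpha> T))"
  by (simp_all add: ribbon_crystal_def word_crystal_def)

text \<open>Since \<open>quasi_ribbon_act_f\<close> makes the changed filling a tableau,
  \<open>filling_of_word\<close> returns exactly this filling. The second claim then carries facts
  about words over to tableaux.\<close>

lemma f_op_ribbon_SomeD:
  assumes T: "T \<in> quasi_ribbon_tableaux \<alpha>" and f: "f_op (ribbon_crystal \<alpha>) i T = Some T'"
  shows "T' \<in> quasi_ribbon_tableaux \<alpha>"
    and "act_word f_letter i (reading_word \<alpha> T) = Some (reading_word \<alpha> T')"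
proof -
  have "\<exists>y\<in>ribbon \<alpha>. T y \<in> {i, up i}"
    by (rule ccontr) (use f act_word_reading_word_None[of \<alpha> T i f_letter] in \<open>auto simp: ribbon_crystal_ops\<close>)
  then obtain y where "y \<in> ribbon \<alpha>" "T y \<in> {i, up i}" ..
  then obtain x where x: "x \<in> ribbon \<alpha>" "T x \<in> {i, up i}"
    "\<And>z. z \<in> ribbon \<alpha> \<Longrightarrow> T z \<in> {i, up i} \<Longrightarrow> z \<noteq> x \<Longrightarrow>
      if even_letter i then reads_before x z else reads_before z x"
    "\<And>g. act_word g i (reading_word \<alpha> T) =
      map_option (\<lambda>b. reading_word \<alpha> (T(x := b))) (g i (T x))"
    by (rule active_node) blast
  have "T x = i" "filling_of_word \<alpha> (reading_word \<alpha> (T(x := up i))) = T'"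
    using f x(4) by (auto simp: ribbon_crystal_ops f_letter_def split: if_splits)
  moreover have "T(x := up i) \<in> quasi_ribbon_tableaux \<alpha>"
    using T x(1) \<open>T x = i\<close> x(3) by (rule quasi_ribbon_act_f)
  ultimately have "T' = T(x := up i)"
    using quasi_ribbon_filling filling_of_reading_word by metis
  with \<open>T x = i\<close> \<open>T(x := up i) \<in> _\<close> x(4)
  show "T' \<in> quasi_ribbon_tableaux \<alpha>"
    and "act_word f_letter i (reading_word \<alpha> T) = Some (reading_word \<alpha> T')"
    by (auto simp: f_letter_def)
qed

lemma e_op_ribbon_SomeD:
  assumes T: "T \<in> quasi_ribbon_tableaux \<alpha>" and e: "e_op (ribbon_crystal \<alpha>) i T = Some T'"
  shows "T' \<in> quasi_ribbon_tableaux \<alpha>"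
    and "act_word e_letter i (reading_word \<alpha> T) = Some (reading_word \<alpha> T')"
proof -
  have "\<exists>y\<in>ribbon \<alpha>. T y \<in> {i, up i}"
    by (rule ccontr) (use e act_word_reading_word_None[of \<alpha> T i e_letter] in \<open>auto simp: ribbon_crystal_ops\<close>)
  then obtain y where "y \<in> ribbon \<alpha>" "T y \<in> {i, up i}" ..
  then obtain x where x: "x \<in> ribbon \<alpha>" "T x \<in> {i, up i}"
    "\<And>z. z \<in> ribbon \<alpha> \<Longrightarrow> T z \<in> {i, up i} \<Longrightarrow> z \<noteq> x \<Longrightarrow>
      if even_letter i then reads_before x z else reads_before z x"
    "\<And>g. act_word g i (reading_word \<alpha> T) =
      map_option (\<lambda>b. reading_word \<alpha> (T(x := b))) (g i (T x))"
    by (rule active_node) blast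
  have "T x = up i" "filling_of_word \<alpha> (reading_word \<alpha> (T(x := i))) = T'"
    using e x(4) by (auto simp: ribbon_crystal_ops e_letter_def split: if_splits)
  moreover have "T(x := i) \<in> quasi_ribbon_tableaux \<alpha>"
    using T x(1) \<open>T x = up i\<close> x(3) by (rule quasi_ribbon_act_e)
  ultimately have "T' = T(x := i)"
    using quasi_ribbon_filling filling_of_reading_word by metis
  with \<open>T x = up i\<close> \<open>T(x := i) \<in> _\<close> x(4)
  show "T' \<in> quasi_ribbon_tableaux \<alpha>"
    and "act_word e_letter i (reading_word \<alpha> T) = Some (reading_word \<alpha> T')"
    by (auto simp: e_letter_def)
qed

lemma f_e_ribbon_inverse:
  assumes T: "T \<in> quasi_ribbon_tableaux \<alpha>" and T': "T' \<in> quasi_ribbon_tableaux \<alpha>"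
  shows "f_op (ribbon_crystal \<alpha>) i T = Some T' \<longleftrightarrow> e_op (ribbon_crystal \<alpha>) i T' = Some T"
proof
  assume "f_op (ribbon_crystal \<alpha>) i T = Some T'"
  from f_op_ribbon_SomeD(2)[OF T this] show "e_op (ribbon_crystal \<alpha>) i T' = Some T"
    using filling_of_reading_word[OF quasi_ribbon_filling[OF T]]
    by (simp add: ribbon_crystal_ops act_word_f_e_inverse)
next
  assume "e_op (ribbon_crystal \<alpha>) i T' = Some T"
  from e_op_ribbon_SomeD(2)[OF T' this] show "f_op (ribbon_crystal \<alpha>) i T = Some T'"
    using filling_of_reading_word[OF quasi_ribbon_filling[OF T']]
    by (simp add: ribbon_crystal_ops flip: act_word_f_e_inverse)
qed

lemma gl_crystal_ribbon_crystal: "gl_crystal (ribbon_crystal \<alpha>)"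
proof -
  let ?C = "ribbon_crystal \<alpha>"
  have f: "int (eps ?C i b') = int (eps ?C i b) + 1 \<and>
      int (phi ?C i b') = int (phi ?C i b) - 1 \<and> wt ?C b' = wt ?C b - simple_root i"
    if "b \<in> elems ?C" "f_op ?C i b = Some b'" for i b b'
    using f_word_SomeD[OF f_op_ribbon_SomeD(2)[of b \<alpha> i b']] that by simp
  have e: "int (eps ?C i b') = int (eps ?C i b) - 1 \<and>
      int (phi ?C i b') = int (phi ?C i b) + 1 \<and> wt ?C b' = wt ?C b + simple_root i"
    if "b \<in> elems ?C" "b' \<in> elems ?C" "e_op ?C i b = Some b'" for i b b'
  proof -
    \<comment> \<open>The axiom for e_i at b is the axiom for f_i at b', read backwards.\<close>
    have "f_op ?C i b' = Some b"
      using that f_e_ribbon_inverse by simp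
    from f[OF that(2) this] show ?thesis
      by (simp del: ribbon_crystal_simps)
  qed
  have closed_e: "e_op ?C i b \<in> insert None (Some ` elems ?C)" if "b \<in> elems ?C" for i b
    using that by (cases "e_op ?C i b") (auto dest: e_op_ribbon_SomeD(1))
  have closed_f: "f_op ?C i b \<in> insert None (Some ` elems ?C)" if "b \<in> elems ?C" for i b
    using that by (cases "f_op ?C i b") (auto dest: f_op_ribbon_SomeD(1))
  have phi_eps: "phi ?C i b + eps ?C i b = (if form (wt ?C b) (simple_root i) \<noteq> 0 then 1 else 0)"
    for i b
    by (simp only: ribbon_crystal_simps phi_eps_word)
  have inverse: "f_op ?C i b = Some b' \<longleftrightarrow> e_op ?C i b' = Some b"
    if "b \<in> elems ?C" "b' \<in> elems ?C" for i b b'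
    using f_e_ribbon_inverse that by simp
  show ?thesis
    unfolding gl_crystal_def
    by (intro conjI allI ballI impI closed_e closed_f phi_eps inverse) (blast dest: e f)+
qed


subsection \<open>The path from northwest to southeast\<close>

lemma set_ribbon_nodes: "set (ribbon_nodes \<alpha>) = ribbon \<alpha>"
  by (auto simp: ribbon_nodes_def ribbon_def)

lemma distinct_ribbon_nodes: "distinct (ribbon_nodes \<alpha>)"
proof -
  have "distinct (concat (map (row_nodes \<alpha>) [0..<n]))" for n
    by (induction n) (auto simp: row_nodes_def distinct_map inj_on_def)
  then show ?thesis
    by (simp add: ribbon_nodes_def)
qed

text \<open>Each row starts in the column where the preceding one ends. Positivity of the parts
  matters: it keeps \<open>\<alpha> ! n - 1\<close> from being truncated, so that
  \<open>row_start \<alpha> (Suc n)\<close> is the last column of row n.\<close>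

lemma ribbon_nodes_step:
  assumes "composition \<alpha>" "Suc k < length (ribbon_nodes \<alpha>)" "ribbon_nodes \<alpha> ! k = (r, c)"
  shows "ribbon_nodes \<alpha> ! Suc k = (r, Suc c) \<or> ribbon_nodes \<alpha> ! Suc k = (Suc r, c)"
proof -
  let ?P = "\<lambda>x y. y = (fst x, Suc (snd x)) \<or> y = (Suc (fst x), snd x)"
  have row: "successively ?P (row_nodes \<alpha> r)" for r
    by (auto simp: row_nodes_def successively_conv_nth)
  \<comment> \<open>The induction also carries the last node listed so far, which sits directly
    above the first node of the next row.\<close>
  have "successively ?P (concat (map (row_nodes \<alpha>) [0..<n])) \<and>
      (0 < n \<longrightarrow> concat (map (row_nodes \<alpha>) [0..<n]) \<noteq> [] \<and>
        last (concat (map (row_nodes \<alpha>) [0..<n])) = (n - 1, row_start \<alpha> n))"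
    if "n \<le> length \<alpha>" for n
    using that
  proof (induction n)
    case 0
    then show ?case
      by simp
  next
    case (Suc n)
    have pos: "0 < \<alpha> ! n"
      using assms(1) Suc.prems by (simp add: composition_def)
    then have "row_nodes \<alpha> n \<noteq> []" "hd (row_nodes \<alpha> n) = (n, row_start \<alpha> n)"
      "last (row_nodes \<alpha> n) = (n, row_start \<alpha> (Suc n))"
      by (auto simp: row_nodes_def hd_map last_map row_start_def)
    then show ?case
      using Suc row[of n] by (cases "n = 0") (auto simp: successively_append_iff)
  qed
  from this[of "length \<alpha>"] have "successively ?P (ribbon_nodes \<alpha>)"
    by (simp add: ribbon_nodes_def)
  then show ?thesis
    using assms(2,3) by (auto simp: successively_conv_nth)
qed

lemma ribbon_nodes_nth_mem: "k < length (ribbon_nodes \<alpha>) \<Longrightarrow> ribbon_nodes \<alpha> ! k \<in> ribbon \<alpha>"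
  by (metis nth_mem set_ribbon_nodes)

lemma ribbon_row_mono:
  assumes "composition \<alpha>" "j \<le> k" "k < length (ribbon_nodes \<alpha>)"
  shows "fst (ribbon_nodes \<alpha> ! j) \<le> fst (ribbon_nodes \<alpha> ! k)"
    and "snd (ribbon_nodes \<alpha> ! j) \<le> snd (ribbon_nodes \<alpha> ! k)"
  using assms(2,3)
proof (induction k rule: dec_induct)
  case (step k)
  { case 1
    with step ribbon_nodes_step[OF assms(1), of k] show ?case
      by (cases "ribbon_nodes \<alpha> ! k") fastforce
  next
    case 2
    with step ribbon_nodes_step[OF assms(1), of k] show ?case
      by (cases "ribbon_nodes \<alpha> ! k") fastforce }
qed simp_all

section \<open>Tableaux to which no raising operator applies\<close>

context
  fixes \<alpha> T
  assumes comp: "composition \<alpha>" and T: "T \<in> quasi_ribbon_tableaux \<alpha>"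
begin

text \<open>The condition on a repeated entry is precisely the one under which
  \<open>H_entry\<close> keeps its value.\<close>

lemma quasi_ribbon_path_step:
  assumes "Suc k < length (ribbon_nodes \<alpha>)"
  shows "T (ribbon_nodes \<alpha> ! k) \<le> T (ribbon_nodes \<alpha> ! Suc k) \<and>
    (T (ribbon_nodes \<alpha> ! k) = T (ribbon_nodes \<alpha> ! Suc k) \<longrightarrow>
      (even_letter (T (ribbon_nodes \<alpha> ! k)) \<longleftrightarrow>
        fst (ribbon_nodes \<alpha> ! Suc k) = fst (ribbon_nodes \<alpha> ! k)))"
proof -
  obtain r c where rc: "ribbon_nodes \<alpha> ! k = (r, c)"
    by fastforce
  have "(r, c) \<in> ribbon \<alpha>" "ribbon_nodes \<alpha> ! Suc k \<in> ribbon \<alpha>"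
    using ribbon_nodes_nth_mem[of k \<alpha>] ribbon_nodes_nth_mem[of "Suc k" \<alpha>] assms rc by auto
  then show ?thesis
    using ribbon_nodes_step[OF comp assms rc] rc quasi_ribbon_row[OF T, of r c "Suc c"]
      quasi_ribbon_column[OF T, of r c "Suc r"] by (elim disjE) simp_all
qed

lemma quasi_ribbon_path_mono:
  assumes "j \<le> k" "k < length (ribbon_nodes \<alpha>)"
  shows "T (ribbon_nodes \<alpha> ! j) \<le> T (ribbon_nodes \<alpha> ! k)"
  using assms
proof (induction k rule: dec_induct)
  case (step k)
  then show ?case
    using quasi_ribbon_path_step[of k] by auto
qed simp

text \<open>By monotonicity all entries between the two nodes are equal, and an even entry is
  repeated only on steps to the right.\<close>

lemma quasi_ribbon_even_same_row:
  assumes "j \<le> k" "k < length (ribbon_nodes \<alpha>)"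
    and "T (ribbon_nodes \<alpha> ! j) = T (ribbon_nodes \<alpha> ! k)" "even_letter (T (ribbon_nodes \<alpha> ! j))"
  shows "fst (ribbon_nodes \<alpha> ! j) = fst (ribbon_nodes \<alpha> ! k)"
  using assms
proof (induction k rule: dec_induct)
  case (step k)
  have "T (ribbon_nodes \<alpha> ! j) = T (ribbon_nodes \<alpha> ! k)"
    using quasi_ribbon_path_mono[of j k] quasi_ribbon_path_step[of k] step.prems step.hyps by auto
  then show ?case
    using step quasi_ribbon_path_step[of k] by auto
qed simp

text \<open>If the active node held i, it would lie before node k on the path, where the entry is
  larger, and \<open>low\<close> would contradict its extremality in reading order. So it holds
  \<open>up i\<close>, although it may differ from node k.\<close>

lemma raisable:
  assumes k: "k < length (ribbon_nodes \<alpha>)" "T (ribbon_nodes \<alpha> ! k) = up i"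
    and low: "\<And>j. j < k \<Longrightarrow> T (ribbon_nodes \<alpha> ! j) = i \<Longrightarrow>
      if even_letter i then reads_before (ribbon_nodes \<alpha> ! k) (ribbon_nodes \<alpha> ! j)
      else reads_before (ribbon_nodes \<alpha> ! j) (ribbon_nodes \<alpha> ! k)"
  shows "e_op (ribbon_crystal \<alpha>) i T \<noteq> None"
proof -
  let ?y = "ribbon_nodes \<alpha> ! k"
  have y: "?y \<in> ribbon \<alpha>"
    using k(1) by (rule ribbon_nodes_nth_mem)
  moreover have "T ?y \<in> {i, up i}"
    using k(2) by simp
  ultimately obtain x where x: "x \<in> ribbon \<alpha>" "T x \<in> {i, up i}"
    "\<And>z. z \<in> ribbon \<alpha> \<Longrightarrow> T z \<in> {i, up i} \<Longrightarrow> z \<noteq> x \<Longrightarrow>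
      if even_letter i then reads_before x z else reads_before z x"
    "\<And>g. act_word g i (reading_word \<alpha> T) =
      map_option (\<lambda>b. reading_word \<alpha> (T(x := b))) (g i (T x))"
    by (rule active_node) blast
  have "T x \<noteq> i"
  proof
    assume i: "T x = i"
    obtain j where j: "j < length (ribbon_nodes \<alpha>)" "ribbon_nodes \<alpha> ! j = x"
      using x(1) by (metis in_set_conv_nth set_ribbon_nodes)
    have "\<not> k \<le> j"
      using quasi_ribbon_path_mono[of k j] j i k(2) by (auto simp: letter_le_iff_rank)
    moreover have "?y \<noteq> x"
      using i k(2) by auto
    ultimately show False
      using low[of j] x(3)[OF y] i j k(2) by (auto simp: reads_before_def split: if_splits)
  qed
  then show ?thesis
    using x(2,4) by (simp add: ribbon_crystal_ops e_letter_def)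
qed

text \<open>Induction along the path: unless some e_i applies, an entry can grow only to the next
  letter, and only on a step on which \<open>H_entry\<close> grows too.\<close>

lemma H_entry_of_unraisable:
  assumes none: "\<And>i. e_op (ribbon_crystal \<alpha>) i T = None"
  shows "k < length (ribbon_nodes \<alpha>) \<Longrightarrow> T (ribbon_nodes \<alpha> ! k) = H_entry \<alpha> k"
proof (induction k)
  case 0
  \<comment> \<open>No node precedes the first one, so an entry \<open>up i\<close> there would make
    e_i applicable.\<close>
  then show ?case
    using letter_cases[of "T (ribbon_nodes \<alpha> ! 0)"] raisable[of 0] none by auto
next
  case (Suc k)
  let ?x = "ribbon_nodes \<alpha> ! k" and ?y = "ribbon_nodes \<alpha> ! Suc k"
  note step = quasi_ribbon_path_step[OF Suc.prems]
  have IH: "T ?x = H_entry \<alpha> k"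
    using Suc by simp
  show ?case
  proof (cases "T ?y = T ?x")
    case True
    then show ?thesis
      using step IH by auto
  next
    case False
    then have less: "T ?x < T ?y"
      using step by auto
    then obtain i where i: "T ?y = up i"
      using letter_cases[of "T ?y"] by (auto simp: letter_less_iff_rank letter_eq_iff_rank)
    have not_low: "\<not> (\<forall>j<Suc k. T (ribbon_nodes \<alpha> ! j) = i \<longrightarrow>
        (if even_letter i then reads_before ?y (ribbon_nodes \<alpha> ! j)
         else reads_before (ribbon_nodes \<alpha> ! j) ?y))"
    proof
      assume "\<forall>j<Suc k. T (ribbon_nodes \<alpha> ! j) = i \<longrightarrow>
        (if even_letter i then reads_before ?y (ribbon_nodes \<alpha> ! j)
         else reads_before (ribbon_nodes \<alpha> ! j) ?y)"
      then have "e_op (ribbon_crystal \<alpha>) i T \<noteq> None"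
        by (intro raisable[OF Suc.prems i]) blast
      then show False
        using none by simp
    qed
    \<comment> \<open>The failure of \<open>raisable\<close> yields an earlier node j with entry i
      on the wrong side of y in reading order.\<close>
    then obtain j where j: "j \<le> k" "T (ribbon_nodes \<alpha> ! j) = i"
      and bad: "\<not> (if even_letter i then reads_before ?y (ribbon_nodes \<alpha> ! j)
         else reads_before (ribbon_nodes \<alpha> ! j) ?y)"
      by (auto simp: less_Suc_eq_le)
    \<comment> \<open>The entry at x is squeezed between i at node j and \<open>up i\<close> at
      y.\<close>
    have x: "T ?x = i"
      using quasi_ribbon_path_mono[of j k] j i less Suc.prems
      by (auto simp: letter_le_iff_rank letter_less_iff_rank letter_eq_iff_rank)
    obtain r c where rc: "?x = (r, c)"
      by fastforce
    \<comment> \<open>This is the condition under which \<open>H_entry\<close> moves up.\<close>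
    have "even_letter i \<longleftrightarrow> fst ?y \<noteq> fst ?x"
    proof (cases "even_letter i")
      case True
      have "fst ?y \<noteq> fst ?x"
      proof
        assume "fst ?y = fst ?x"
        then have "?y = (r, Suc c)"
          using ribbon_nodes_step[OF comp Suc.prems rc] rc by (metis fst_conv n_not_Suc_n)
        \<comment> \<open>Equal even entries put j into the row of x. Hence y is to the right of j
          and read before it, against \<open>bad\<close>.\<close>
        then show False
          using bad True ribbon_row_mono(2)[OF comp j(1)] Suc.prems rc
            quasi_ribbon_even_same_row[of j k] j x by (auto simp: reads_before_def)
      qed
      then show ?thesis
        using True by simp
    next
      case False
      \<comment> \<open>By \<open>bad\<close>, y is not in a lower row than j, hence not in a lower
        row than x, and the step goes to the right.\<close>
      then have "fst ?y \<le> fst (ribbon_nodes \<alpha> ! j)"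
        using bad by (auto simp: reads_before_def)
      then have "fst ?y \<le> fst ?x"
        using ribbon_row_mono(1)[OF comp j(1)] Suc.prems by auto
      then show ?thesis
        using False ribbon_nodes_step[OF comp Suc.prems rc] rc by auto
    qed
    then show ?thesis
      using IH x i by auto
  qed
qed

lemma unraisable_eq_H_tab:
  assumes "\<And>i. e_op (ribbon_crystal \<alpha>) i T = None"
  shows "T = H_tab \<alpha>"
proof (rule PiE_ext)
  show "T \<in> ribbon \<alpha> \<rightarrow>\<^sub>E UNIV"
    using quasi_ribbon_filling[OF T] by (simp add: fillings_def)
  show "H_tab \<alpha> \<in> ribbon \<alpha> \<rightarrow>\<^sub>E UNIV"
    by (simp add: H_tab_def)
  fix x
  assume x: "x \<in> ribbon \<alpha>"
  then obtain k where k: "k < length (ribbon_nodes \<alpha>)" "ribbon_nodes \<alpha> ! k = x"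
    by (metis in_set_conv_nth set_ribbon_nodes)
  then have "(THE k. k < length (ribbon_nodes \<alpha>) \<and> ribbon_nodes \<alpha> ! k = x) = k"
    using distinct_ribbon_nodes[of \<alpha>] by (intro the_equality) (auto simp: nth_eq_iff_index_eq)
  then show "T x = H_tab \<alpha> x"
    using H_entry_of_unraisable[OF assms k(1)] k(2) x by (simp add: H_tab_def)
qed

end


subsection \<open>Depth\<close>

text \<open>The linear functional with value \<open>rank a\<close> on \<open>\<epsilon> a\<close>.
  Extending linearly into the multiples of the single generator \<open>\<epsilon> half\<close> and
  taking the coefficient makes additivity immediate.\<close>

definition depth :: "weight \<Rightarrow> int"
  where "depth \<mu> = Poly_Mapping.lookup (frag_extend (\<lambda>a. frag_cmul (int (rank a)) (\<epsilon> half)) \<mu>) half"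

lemma depth_add: "depth (\<mu> + \<nu>) = depth \<mu> + depth \<nu>"
  by (simp add: depth_def frag_extend_add lookup_add)

lemma depth_diff: "depth (\<mu> - \<nu>) = depth \<mu> - depth \<nu>"
  by (simp add: depth_def frag_extend_diff lookup_minus)

lemma depth_cmul: "depth (frag_cmul c \<mu>) = c * depth \<mu>"
  by (simp add: depth_def frag_extend_cmul)

lemma depth_0: "depth 0 = 0"
  by (simp add: depth_def)

lemma depth_\<epsilon>: "depth (\<epsilon> a) = int (rank a)"
  by (simp add: depth_def)

lemma depth_sum: "depth (sum g A) = (\<Sum>a\<in>A. depth (g a))"
  by (induction A rule: infinite_finite_induct) (auto simp: depth_0 depth_add)

lemma depth_simple_root: "depth (simple_root i) = - 1"
  by (simp add: simple_root_def depth_diff depth_\<epsilon>)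

text \<open>The difference of the weights is a nonnegative combination of simple roots, each of
  depth -1.\<close>

lemma depth_mono: "weight_ge \<mu> \<nu> \<Longrightarrow> depth \<mu> \<le> depth \<nu>"
proof -
  assume "weight_ge \<mu> \<nu>"
  then obtain c :: "letter \<Rightarrow>\<^sub>0 nat" where
    "\<mu> - \<nu> = (\<Sum>i\<in>Poly_Mapping.keys c. frag_cmul (int (Poly_Mapping.lookup c i)) (simple_root i))"
    by (auto simp: weight_ge_def)
  then have "depth (\<mu> - \<nu>) \<le> 0"
    by (simp add: depth_sum depth_cmul depth_simple_root sum_nonneg sum_negf)
  then show ?thesis
    by (simp add: depth_diff)
qed

lemma depth_wt_word_nonneg: "0 \<le> depth (wt word_crystal w)"
  by (induction w) (auto simp: word_crystal_def depth_0 depth_add depth_\<epsilon>)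

section \<open>Closure properties of the weight order\<close>

lemma weight_ge_refl: "weight_ge \<mu> \<mu>"
  unfolding weight_ge_def by (rule exI[of _ 0]) simp

text \<open>The coefficient at i grows by one, which may enlarge the support; the sums are therefore
  compared over the common index set \<open>?A\<close>.\<close>

lemma weight_ge_diff_simple_root:
  assumes "weight_ge \<mu> \<nu>"
  shows "weight_ge \<mu> (\<nu> - simple_root i)"
proof -
  obtain c :: "letter \<Rightarrow>\<^sub>0 nat" where
    c: "\<mu> - \<nu> = (\<Sum>j\<in>Poly_Mapping.keys c. frag_cmul (int (Poly_Mapping.lookup c j)) (simple_root j))"
    using assms by (auto simp: weight_ge_def)
  let ?d = "c + Poly_Mapping.single i 1"
  let ?A = "insert i (Poly_Mapping.keys c)"
  have keys: "Poly_Mapping.keys ?d \<subseteq> ?A"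
    using Poly_Mapping.keys_add[of c "Poly_Mapping.single i 1"] by auto
  have "(\<Sum>j\<in>Poly_Mapping.keys ?d. frag_cmul (int (Poly_Mapping.lookup ?d j)) (simple_root j)) =
      (\<Sum>j\<in>?A. frag_cmul (int (Poly_Mapping.lookup ?d j)) (simple_root j))"
    using keys by (intro sum.mono_neutral_left) (auto simp: in_keys_iff)
  also have "\<dots> = (\<Sum>j\<in>?A. frag_cmul (int (Poly_Mapping.lookup c j)) (simple_root j)) +
      (\<Sum>j\<in>?A. if j = i then simple_root j else 0)"
    unfolding sum.distrib[symmetric]
    by (intro sum.cong) (auto simp: lookup_add lookup_single frag_cmul_distrib)
  also have "(\<Sum>j\<in>?A. if j = i then simple_root j else 0) = simple_root i"
    by simp
  also have "(\<Sum>j\<in>?A. frag_cmul (int (Poly_Mapping.lookup c j)) (simple_root j)) = \<mu> - \<nu>"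
    unfolding c by (intro sum.mono_neutral_right) (auto simp: in_keys_iff)
  finally have "\<mu> - (\<nu> - simple_root i) =
      (\<Sum>j\<in>Poly_Mapping.keys ?d. frag_cmul (int (Poly_Mapping.lookup ?d j)) (simple_root j))"
    by simp
  then show ?thesis
    unfolding weight_ge_def by blast
qed


subsection \<open>Generation by the highest weight element\<close>

text \<open>A filling governed by row plus column is strict in both directions. One tableau is
  enough to show, by raising it, that \<open>H_tab \<alpha>\<close> is a tableau.\<close>

lemma quasi_ribbon_tableaux_nonempty: "quasi_ribbon_tableaux \<alpha> \<noteq> {}"
proof -
  have rank: "rank ((up ^^ n) half) = Suc n" for n
    by (induction n) auto
  have "(\<lambda>x\<in>ribbon \<alpha>. (up ^^ (fst x + snd x)) half) \<in> quasi_ribbon_tableaux \<alpha>"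
    by (rule quasi_ribbon_tableauI)
      (auto simp: fillings_def letter_le_iff_rank letter_eq_iff_rank rank)
  then show ?thesis
    by blast
qed

lemma f_seq_Nil [simp]: "f_seq C [] x = x"
  by (simp add: f_seq_def)

lemma f_seq_Cons [simp]: "f_seq C (i # js) x = Option.bind (f_seq C js x) (f_op C i)"
  by (simp add: f_seq_def)

lemma e_op_ribbon_depth:
  assumes "T \<in> quasi_ribbon_tableaux \<alpha>" "e_op (ribbon_crystal \<alpha>) i T = Some T'"
  shows "depth (wt (ribbon_crystal \<alpha>) T) = depth (wt (ribbon_crystal \<alpha>) T') + 1"
  using f_word_SomeD(5)[of i "reading_word \<alpha> T'" "reading_word \<alpha> T"] e_op_ribbon_SomeD[OF assms]
  by (simp add: act_word_f_e_inverse depth_diff depth_simple_root)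

text \<open>Induction on depth. Membership of \<open>H_tab \<alpha>\<close> belongs to the claim
  because it is obtained from the end point of raising T; the raising path read backwards gives the
  indices \<open>js\<close>.\<close>

lemma generated_by_H_tab:
  assumes "composition \<alpha>" "T \<in> quasi_ribbon_tableaux \<alpha>"
  shows "H_tab \<alpha> \<in> quasi_ribbon_tableaux \<alpha> \<and>
    (\<exists>js. f_seq (ribbon_crystal \<alpha>) js (Some (H_tab \<alpha>)) = Some T)"
  using assms(2)
proof (induction "nat (depth (wt (ribbon_crystal \<alpha>) T))" arbitrary: T rule: less_induct)
  case less
  show ?case
  proof (cases "\<forall>i. e_op (ribbon_crystal \<alpha>) i T = None")
    case True
    then have "T = H_tab \<alpha>"
      using unraisable_eq_H_tab[OF assms(1) less.prems] by blast
    then show ?thesis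
      using less.prems f_seq_Nil by blast
  next
    case False
    then obtain i T' where e: "e_op (ribbon_crystal \<alpha>) i T = Some T'"
      by auto
    note T' = e_op_ribbon_SomeD(1)[OF less.prems e]
    \<comment> \<open>Nonnegativity of the depth makes the decrease survive the truncation by
      \<open>nat\<close>.\<close>
    have "nat (depth (wt (ribbon_crystal \<alpha>) T')) < nat (depth (wt (ribbon_crystal \<alpha>) T))"
      using e_op_ribbon_depth[OF less.prems e] depth_wt_word_nonneg[of "reading_word \<alpha> T'"] by simp
    from less.hyps[OF this T'] obtain js where
      "H_tab \<alpha> \<in> quasi_ribbon_tableaux \<alpha>"
      "f_seq (ribbon_crystal \<alpha>) js (Some (H_tab \<alpha>)) = Some T'"
      by blast
    moreover have "f_op (ribbon_crystal \<alpha>) i T' = Some T"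
      using e f_e_ribbon_inverse[OF T' less.prems] by blast
    ultimately have "f_seq (ribbon_crystal \<alpha>) (i # js) (Some (H_tab \<alpha>)) = Some T"
      by simp
    then show ?thesis
      using \<open>H_tab \<alpha> \<in> _\<close> by blast
  qed
qed

text \<open>Membership is carried through the induction because the last arrow and the last drop in
  weight are available only once the preceding element is known to be a tableau.\<close>

lemma f_seq_ribbon_SomeD:
  assumes "T \<in> quasi_ribbon_tableaux \<alpha>" "f_seq (ribbon_crystal \<alpha>) js (Some T) = Some T'"
  shows "T' \<in> quasi_ribbon_tableaux \<alpha> \<and> (T, T') \<in> (arrows (ribbon_crystal \<alpha>))\<^sup>* \<and>
    weight_ge (wt (ribbon_crystal \<alpha>) T) (wt (ribbon_crystal \<alpha>) T')"
  using assms(2)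
proof (induction js arbitrary: T')
  case Nil
  then show ?case
    using assms(1) by (auto simp: weight_ge_refl)
next
  case (Cons i js)
  then obtain U where U: "f_seq (ribbon_crystal \<alpha>) js (Some T) = Some U"
    "f_op (ribbon_crystal \<alpha>) i U = Some T'"
    by (auto simp: bind_eq_Some_conv)
  note IH = Cons.IH[OF U(1)]
  note T' = f_op_ribbon_SomeD[OF conjunct1[OF IH] U(2)]
  have "(U, T') \<in> arrows (ribbon_crystal \<alpha>)"
    using IH T'(1) U(2) by (auto simp: arrows_def)
  moreover have "wt (ribbon_crystal \<alpha>) T' = wt (ribbon_crystal \<alpha>) U - simple_root i"
    using f_word_SomeD(5)[OF T'(2)] by simp
  ultimately show ?case
    using IH T'(1) by (auto simp del: ribbon_crystal_simps
        intro: weight_ge_diff_simple_root rtrancl.rtrancl_into_rtrancl)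
qed

theorem theorem3p1:
  fixes \<alpha> :: "nat list"
  assumes "composition \<alpha>"
  shows "gl_crystal (ribbon_crystal \<alpha>) \<and>
    Some ` quasi_ribbon_tableaux \<alpha>
      = {f_seq (ribbon_crystal \<alpha>) js (Some (H_tab \<alpha>)) | js. True} - {None} \<and>
    connected_crystal (ribbon_crystal \<alpha>) \<and>
    highest_weight_element (ribbon_crystal \<alpha>) (H_tab \<alpha>) \<and>
    (\<forall>H. highest_weight_element (ribbon_crystal \<alpha>) H \<longrightarrow> H = H_tab \<alpha>)"
proof (intro conjI allI impI)
  let ?C = "ribbon_crystal \<alpha>" and ?B = "quasi_ribbon_tableaux \<alpha>" and ?H = "H_tab \<alpha>"
  have H: "?H \<in> ?B"
    using quasi_ribbon_tableaux_nonempty generated_by_H_tab[OF assms] by blast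
  note gen = generated_by_H_tab[OF assms, THEN conjunct2]
  show "gl_crystal ?C"
    by (rule gl_crystal_ribbon_crystal)
  show "Some ` ?B = {f_seq ?C js (Some ?H) | js. True} - {None}"
  proof (intro equalityI subsetI)
    fix y
    assume "y \<in> Some ` ?B"
    then obtain T js where "y = Some T" "f_seq ?C js (Some ?H) = Some T"
      using gen by blast
    then have "y = f_seq ?C js (Some ?H)" "y \<noteq> None"
      by simp_all
    then show "y \<in> {f_seq ?C js (Some ?H) | js. True} - {None}"
      by blast
  next
    fix y
    assume "y \<in> {f_seq ?C js (Some ?H) | js. True} - {None}"
    then obtain js where "y = f_seq ?C js (Some ?H)" "y \<noteq> None"
      by blast
    then obtain T where "y = Some T" "f_seq ?C js (Some ?H) = Some T"
      by auto
    then show "y \<in> Some ` ?B"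
      using f_seq_ribbon_SomeD[OF H] by blast
  qed
  have reach: "(?H, T) \<in> (arrows ?C)\<^sup>* \<and> weight_ge (wt ?C ?H) (wt ?C T)" if "T \<in> ?B" for T
    using gen[OF that] f_seq_ribbon_SomeD[OF H] by blast
  show "connected_crystal ?C"
    unfolding connected_crystal_def
  proof (intro ballI)
    fix T T'
    assume "T \<in> elems ?C" "T' \<in> elems ?C"
    \<comment> \<open>Go up from T to \<open>?H\<close> against the arrows, then down to T'.\<close>
    then have "(T, ?H) \<in> ((arrows ?C)\<inverse>)\<^sup>*" "(?H, T') \<in> (arrows ?C)\<^sup>*"
      using reach by (simp_all add: rtrancl_converse)
    then have "(T, ?H) \<in> (arrows ?C \<union> (arrows ?C)\<inverse>)\<^sup>*" "(?H, T') \<in> (arrows ?C \<union> (arrows ?C)\<inverse>)\<^sup>*"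
      by (meson Un_upper1 Un_upper2 rtrancl_mono subsetD)+
    then show "(T, T') \<in> (arrows ?C \<union> (arrows ?C)\<inverse>)\<^sup>*"
      by (rule rtrancl_trans)
  qed
  show "highest_weight_element ?C ?H"
    using H reach by (simp add: highest_weight_element_def)
  fix K
  assume K: "highest_weight_element ?C K"
  then have "K \<in> ?B"
    by (simp add: highest_weight_element_def)
  moreover have "e_op ?C i K = None" for i
  proof (rule ccontr)
    assume "e_op ?C i K \<noteq> None"
    then obtain T where e: "e_op ?C i K = Some T"
      by auto
    have "weight_ge (wt ?C K) (wt ?C T)"
      using K e_op_ribbon_SomeD(1)[OF \<open>K \<in> ?B\<close> e] by (simp add: highest_weight_element_def)
    \<comment> \<open>Applying e_i lowers the depth by one, while the maximal weight of K has the
      least depth.\<close>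
    then show False
      using depth_mono e_op_ribbon_depth[OF \<open>K \<in> ?B\<close> e] by fastforce
  qed
  ultimately show "K = ?H"
    using unraisable_eq_H_tab[OF assms] by blast
qed

end
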